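(* For $n\ge 1$ let $$f_n(x,y,z) := \sum_{\pi\in S_n} x^{{\rm inv}(\pi)}\, y^{{\rm maj}(\pi)}\, z^{{\rm last}(\pi)}.$$ Then $f_1(x,y,z)=1$ and, for every $n\ge 2$, $$(x-z)\,f_n(x,y,z) = (x^{n}y^{n-1} - z^{n})\, f_{n-1}(x,y,1) + x^{n-1}(1-y^{n-1})\, z\, f_{n-1}(x,y,z/x),$$ as an identity of Laurent polynomials in $x,y,z$.
   Context: $S_n$ is the symmetric group on $\{1,\dots,n\}$, permutations written in one-line notation $(\pi(1),\dots,\pi(n))$. ${\rm inv}(\pi)=\#\{(i,j): i<j,\ \pi(i)>\pi(j)\}$ is the inversion number; ${\rm maj}(\pi)=\sum\{\,i : 1\le i\le n-1,\ \pi(i)>\pi(i+1)\,\}$ is the major index; ${\rm last}(\pi):=\pi(n)-1$. *)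

theory Defs
  imports
    "HOL-Combinatorics.Permutations"
    "HOL-Library.Poly_Mapping"
    "HOL-Library.Product_Plus"
begin

definition inv_num :: "nat \<Rightarrow> (nat \<Rightarrow> nat) \<Rightarrow> nat" where
  "inv_num n \<pi> = card {(i, j). i \<in> {1..n} \<and> j \<in> {1..n} \<and> i < j \<and> \<pi> i > \<pi> j}"

definition maj :: "nat \<Rightarrow> (nat \<Rightarrow> nat) \<Rightarrow> nat" where
  "maj n \<pi> = \<Sum>{i. 1 \<le> i \<and> i \<le> n - 1 \<and> \<pi> i > \<pi> (i + 1)}"

definition last_stat :: "nat \<Rightarrow> (nat \<Rightarrow> nat) \<Rightarrow> nat" where
  "last_stat n \<pi> = \<pi> n - 1"

text \<open>The polynomial is a function on an arbitrary commutative ring, so that substitutions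
  such as $z \mapsto 1$ and $z \mapsto z/x$ are plain function application.\<close>

definition f_poly :: "nat \<Rightarrow> 'a::comm_ring_1 \<Rightarrow> 'a \<Rightarrow> 'a \<Rightarrow> 'a" where
  "f_poly n x y z = (\<Sum>\<pi> | \<pi> permutes {1..n}. x ^ inv_num n \<pi> * y ^ maj n \<pi> * z ^ last_stat n \<pi>)"

text \<open>Laurent polynomials in $x,y,z$ over the integers are the group ring of $\mathbb{Z}^3$:
  finitely supported maps from exponent vectors to coefficients, with convolution product.\<close>

type_synonym laurent3 = "(int \<times> int \<times> int) \<Rightarrow>\<^sub>0 int"

definition LX :: laurent3 where "LX = Poly_Mapping.single (1, 0, 0) 1"
definition LX_inv :: laurent3 where "LX_inv = Poly_Mapping.single (-1, 0, 0) 1"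
definition LY :: laurent3 where "LY = Poly_Mapping.single (0, 1, 0) 1"
definition LZ :: laurent3 where "LZ = Poly_Mapping.single (0, 0, 1) 1"

lemma LX_mult_LX_inv: "LX * LX_inv = 1"
  by (simp add: LX_def LX_inv_def mult_single flip: single_one zero_prod_def)

end

theory Submission
  imports
    Defs
    "HOL-Combinatorics.Cycles"
begin

text \<open>Every permutation of \<open>{1..n + 1}\<close> with last value \<open>k\<close> is uniquely \<open>c \<circ> \<sigma>\<close>, where \<open>\<sigma>\<close> permutes
  \<open>{1..n}\<close> and \<open>c\<close> is the cycle \<open>k \<mapsto> k + 1 \<mapsto> \<dots> \<mapsto> n + 1 \<mapsto> k\<close>. As \<open>c\<close> is increasing on \<open>{1..n}\<close>,
  passing from \<open>\<sigma>\<close> to \<open>c \<circ> \<sigma>\<close> only creates the \<open>n + 1 - k\<close> inversions with the last position, and a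
  descent at \<open>n\<close> exactly when \<open>k \<le> \<sigma> n\<close>. For fixed \<open>\<sigma>\<close> the sum over \<open>k\<close> therefore splits at \<open>\<sigma> n\<close>
  into two geometric sums of ratio \<open>z / x\<close>, which telescope after multiplication by \<open>x - z\<close>.\<close>

lemma bij_betw_comp_permutes_insert:
  assumes "a \<notin> S"
    and permutes: "\<And>b. b \<in> insert a S \<Longrightarrow> c b permutes insert a S"
    and apply_a: "\<And>b. b \<in> insert a S \<Longrightarrow> c b a = b"
  shows "bij_betw (\<lambda>(b, p). c b \<circ> p) (insert a S \<times> {p. p permutes S}) {p. p permutes insert a S}"
    (is "bij_betw ?f ?P ?Q")
proof -
  define g where "g q = (q a, inv (c (q a)) \<circ> q)" for q
  have image_a: "q a \<in> insert a S" if "q permutes insert a S" for q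
    using permutes_in_image[OF that, of a] by simp
  show ?thesis
  proof (rule bij_betw_byWitness[where f' = g])
    show "\<forall>x \<in> ?P. g (?f x) = x"
    proof clarify
      fix b p
      assume b: "b \<in> insert a S" and p: "p permutes S"
      have "(c b \<circ> p) a = b"
        using apply_a[OF b] permutes_not_in[OF p \<open>a \<notin> S\<close>] by simp
      moreover have "inv (c b) \<circ> (c b \<circ> p) = p"
        using permutes_inv_o(2)[OF permutes[OF b]] by (simp flip: comp_assoc)
      ultimately show "g (c b \<circ> p) = (b, p)"
        by (simp add: g_def)
    qed
    show "\<forall>q \<in> ?Q. ?f (g q) = q"
      using permutes_inv_o(1)[OF permutes[OF image_a]] by (simp add: g_def flip: comp_assoc)
    show "?f ` ?P \<subseteq> ?Q"
      using permutes permutes_imp_permutes_insert[of _ S a] permutes_compose by fastforce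
    have "inv (c (q a)) \<circ> q permutes S" if q: "q permutes insert a S" for q
    proof (rule permutes_superset)
      note c = permutes[OF image_a[OF q]]
      show "inv (c (q a)) \<circ> q permutes insert a S"
        using q permutes_inv[OF c] by (rule permutes_compose)
      show "(inv (c (q a)) \<circ> q) x = x" if "x \<in> insert a S - S" for x
        using that apply_a[OF image_a[OF q]] by (auto simp: permutes_inv_eq[OF c])
    qed
    then show "g ` ?Q \<subseteq> ?P"
      using image_a by (auto simp: g_def)
  qed
qed

definition interval_cycle :: "nat \<Rightarrow> nat \<Rightarrow> nat \<Rightarrow> nat" where
  "interval_cycle k n = cycle_of_list [k..<Suc n]"

lemma interval_cycle_permutes:
  assumes "a \<le> k"
  shows "interval_cycle k n permutes {a..n}"
proof (rule permutes_subset)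
  show "interval_cycle k n permutes {k..n}"
    using cycle_permutes[of "[k..<Suc n]"]
    by (simp add: interval_cycle_def atLeastLessThanSuc_atLeastAtMost del: upt_Suc)
qed (use assms in auto)

lemma interval_cycle_apply:
  assumes "k \<le> n"
  shows "interval_cycle k n v = (if v = n then k else if k \<le> v \<and> v < n then Suc v else v)"
proof -
  have "map (interval_cycle k n) [k..<Suc n] = rotate1 [k..<Suc n]"
    using cyclic_rotation[of "[k..<Suc n]" 1] by (simp add: interval_cycle_def del: upt_Suc)
  also have "\<dots> = [Suc k..<Suc n] @ [k]"
    using assms by (simp add: upt_conv_Cons del: upt_Suc)
  finally have "map (interval_cycle k n) ([k..<n] @ [n]) = map Suc [k..<n] @ [k]"
    using assms by (simp add: map_Suc_upt del: upt_Suc flip: upt_Suc_append)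
  then have "interval_cycle k n n = k" "\<And>v. v \<in> {k..<n} \<Longrightarrow> interval_cycle k n v = Suc v"
    by simp_all
  then show ?thesis
    using permutes_not_in[OF interval_cycle_permutes[OF order_refl], of v k n] by auto
qed

lemma strict_mono_on_interval_cycle:
  assumes "k \<le> n"
  shows "strict_mono_on {..<n} (interval_cycle k n)"
  using assms by (auto simp: strict_mono_on_def interval_cycle_apply)

lemma less_interval_cycle_iff:
  assumes "k \<le> n" "v < n"
  shows "k < interval_cycle k n v \<longleftrightarrow> k \<le> v"
  using assms by (auto simp: interval_cycle_apply)

lemma inv_num_comp_strict_mono_on:
  assumes f: "strict_mono_on A f" and \<pi>: "\<pi> ` {1..n} \<subseteq> A"
  shows "inv_num n (f \<circ> \<pi>) = inv_num n \<pi>"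
proof -
  have "f (\<pi> j) < f (\<pi> i) \<longleftrightarrow> \<pi> j < \<pi> i" if "i \<in> {1..n}" "j \<in> {1..n}" for i j
    using that \<pi> by (intro strict_mono_on_less[OF f]) auto
  then show ?thesis
    unfolding inv_num_def by (intro arg_cong[where f = card]) auto
qed

lemma maj_comp_strict_mono_on:
  assumes f: "strict_mono_on A f" and \<pi>: "\<pi> ` {1..n} \<subseteq> A"
  shows "maj n (f \<circ> \<pi>) = maj n \<pi>"
proof -
  have "f (\<pi> (i + 1)) < f (\<pi> i) \<longleftrightarrow> \<pi> (i + 1) < \<pi> i" if "1 \<le> i" "i \<le> n - 1" for i
    using that \<pi> by (intro strict_mono_on_less[OF f]) auto
  then show ?thesis
    unfolding maj_def by (intro sum.cong) auto
qed

lemma inv_num_Suc: "inv_num (Suc n) \<pi> = inv_num n \<pi> + card {i \<in> {1..n}. \<pi> (Suc n) < \<pi> i}"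
proof -
  let ?I = "{(i, j). i \<in> {1..n} \<and> j \<in> {1..n} \<and> i < j \<and> \<pi> i > \<pi> j}"
  let ?L = "{i \<in> {1..n}. \<pi> (Suc n) < \<pi> i}"
  have "{(i, j). i \<in> {1..Suc n} \<and> j \<in> {1..Suc n} \<and> i < j \<and> \<pi> i > \<pi> j} = ?I \<union> ?L \<times> {Suc n}"
    by (auto simp: le_Suc_eq)
  moreover have "finite ?I"
    by (rule finite_subset[of _ "{1..n} \<times> {1..n}"]) auto
  moreover have "?I \<inter> ?L \<times> {Suc n} = {}"
    by auto
  ultimately show ?thesis
    by (simp add: inv_num_def card_Un_disjoint card_cartesian_product)
qed

lemma inv_num_Suc_permutes:
  assumes \<pi>: "\<pi> permutes {1..Suc n}"
  shows "inv_num (Suc n) \<pi> = inv_num n \<pi> + (Suc n - \<pi> (Suc n))"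
proof -
  let ?L = "{i \<in> {1..n}. \<pi> (Suc n) < \<pi> i}"
  have "?L = {i \<in> {1..Suc n}. \<pi> (Suc n) < \<pi> i}"
    by (auto simp: le_Suc_eq)
  then have "\<pi> ` ?L = \<pi> ` {1..Suc n} \<inter> {\<pi> (Suc n)<..}"
    by auto
  also have "\<dots> = {\<pi> (Suc n)<..Suc n}"
    by (subst permutes_image[OF \<pi>]) auto
  finally have "card ?L = Suc n - \<pi> (Suc n)"
    by (metis card_greaterThanAtMost card_image permutes_inj_on[OF \<pi>])
  then show ?thesis
    by (simp add: inv_num_Suc)
qed

lemma maj_Suc: "maj (Suc n) \<pi> = maj n \<pi> + (if \<pi> (Suc n) < \<pi> n then n else 0)"
proof (cases "n = 0")
  case False
  then have le_n_iff: "i \<le> n \<longleftrightarrow> i \<le> n - 1 \<or> i = n" for i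
    by linarith
  let ?D = "{i. 1 \<le> i \<and> i \<le> n - 1 \<and> \<pi> i > \<pi> (i + 1)}"
  have "{i. 1 \<le> i \<and> i \<le> Suc n - 1 \<and> \<pi> i > \<pi> (i + 1)} =
      (if \<pi> (Suc n) < \<pi> n then insert n ?D else ?D)"
    using False by (auto simp: le_n_iff)
  moreover have "\<Sum>(insert n ?D) = n + \<Sum>?D"
    using False by (intro sum.insert) auto
  ultimately show ?thesis
    unfolding maj_def by (simp only: split: if_split) simp
qed (simp add: maj_def)

lemma bij_betw_interval_cycle_comp:
  "bij_betw (\<lambda>(k, \<sigma>). interval_cycle k (Suc n) \<circ> \<sigma>)
     ({1..Suc n} \<times> {\<sigma>. \<sigma> permutes {1..n}}) {\<pi>. \<pi> permutes {1..Suc n}}"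
proof -
  have insert_Suc: "insert (Suc n) {1..n} = {1..Suc n}"
    by auto
  show ?thesis
    by (rule bij_betw_comp_permutes_insert[of "Suc n" "{1..n}", unfolded insert_Suc])
      (simp_all add: interval_cycle_permutes interval_cycle_apply)
qed

lemma interval_cycle_comp_last:
  assumes "\<sigma> permutes {1..n}" "k \<in> {1..Suc n}"
  shows "(interval_cycle k (Suc n) \<circ> \<sigma>) (Suc n) = k"
  using assms by (simp add: interval_cycle_apply permutes_not_in)

lemma inv_num_interval_cycle_comp:
  assumes \<sigma>: "\<sigma> permutes {1..n}" and k: "k \<in> {1..Suc n}"
  shows "inv_num (Suc n) (interval_cycle k (Suc n) \<circ> \<sigma>) = inv_num n \<sigma> + (Suc n - k)"
proof -
  have "\<sigma> permutes {1..Suc n}"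
    using \<sigma> by (rule permutes_subset) simp
  moreover have "interval_cycle k (Suc n) permutes {1..Suc n}"
    using k by (intro interval_cycle_permutes) simp
  ultimately have "interval_cycle k (Suc n) \<circ> \<sigma> permutes {1..Suc n}"
    by (rule permutes_compose)
  moreover have "inv_num n (interval_cycle k (Suc n) \<circ> \<sigma>) = inv_num n \<sigma>"
    using k permutes_image[OF \<sigma>]
    by (intro inv_num_comp_strict_mono_on[OF strict_mono_on_interval_cycle]) auto
  ultimately show ?thesis
    by (simp only: inv_num_Suc_permutes interval_cycle_comp_last[OF assms])
qed

lemma maj_interval_cycle_comp:
  assumes \<sigma>: "\<sigma> permutes {1..n}" and k: "k \<in> {1..Suc n}"
  shows "maj (Suc n) (interval_cycle k (Suc n) \<circ> \<sigma>) = maj n \<sigma> + (if k \<le> \<sigma> n then n else 0)"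
proof -
  have "\<sigma> n \<le> n"
    using permutes_in_image[OF \<sigma>, of n] permutes_not_in[OF \<sigma>, of n] by fastforce
  then have "k < (interval_cycle k (Suc n) \<circ> \<sigma>) n \<longleftrightarrow> k \<le> \<sigma> n"
    using k less_interval_cycle_iff[of k "Suc n" "\<sigma> n"] by simp
  moreover have "maj n (interval_cycle k (Suc n) \<circ> \<sigma>) = maj n \<sigma>"
    using k permutes_image[OF \<sigma>]
    by (intro maj_comp_strict_mono_on[OF strict_mono_on_interval_cycle]) auto
  ultimately show ?thesis
    by (simp only: maj_Suc interval_cycle_comp_last[OF assms])
qed

definition last_value_sum :: "nat \<Rightarrow> 'a::comm_ring_1 \<Rightarrow> 'a \<Rightarrow> 'a \<Rightarrow> nat \<Rightarrow> 'a" where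
  "last_value_sum n x y z j =
    (\<Sum>k = 1..Suc n. x ^ (Suc n - k) * y ^ (if k \<le> j then n else 0) * z ^ (k - 1))"

lemma f_poly_Suc:
  fixes x y z :: "'a::comm_ring_1"
  shows "f_poly (Suc n) x y z =
    (\<Sum>\<sigma> | \<sigma> permutes {1..n}. x ^ inv_num n \<sigma> * y ^ maj n \<sigma> * last_value_sum n x y z (\<sigma> n))"
proof -
  let ?P = "{\<sigma>. \<sigma> permutes {1..n}}"
  let ?w = "\<lambda>\<pi>. x ^ inv_num (Suc n) \<pi> * y ^ maj (Suc n) \<pi> * z ^ last_stat (Suc n) \<pi>"
  have "f_poly (Suc n) x y z =
      (\<Sum>(k, \<sigma>) \<in> {1..Suc n} \<times> ?P. ?w (interval_cycle k (Suc n) \<circ> \<sigma>))"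
    unfolding f_poly_def
    by (subst sum.reindex_bij_betw[OF bij_betw_interval_cycle_comp, symmetric])
      (simp only: case_prod_unfold)
  also have "\<dots> = (\<Sum>\<sigma> \<in> ?P. \<Sum>k = 1..Suc n. ?w (interval_cycle k (Suc n) \<circ> \<sigma>))"
    by (subst sum.swap) (simp only: sum.cartesian_product)
  also have "\<dots> = (\<Sum>\<sigma> \<in> ?P. x ^ inv_num n \<sigma> * y ^ maj n \<sigma> * last_value_sum n x y z (\<sigma> n))"
    unfolding last_value_sum_def sum_distrib_left
  proof (intro sum.cong refl)
    fix \<sigma> k
    assume "\<sigma> \<in> ?P" and k: "k \<in> {1..Suc n}"
    then have \<sigma>: "\<sigma> permutes {1..n}" by simp
    show "?w (interval_cycle k (Suc n) \<circ> \<sigma>) = x ^ inv_num n \<sigma> * y ^ maj n \<sigma> *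
        (x ^ (Suc n - k) * y ^ (if k \<le> \<sigma> n then n else 0) * z ^ (k - 1))"
      unfolding last_stat_def interval_cycle_comp_last[OF \<sigma> k]
        inv_num_interval_cycle_comp[OF \<sigma> k] maj_interval_cycle_comp[OF \<sigma> k]
      by (simp only: power_add mult_ac)
  qed
  finally show ?thesis .
qed

lemma diff_mult_geometric_sum:
  fixes x z :: "'a::comm_ring_1"
  assumes "a \<le> b" "b \<le> n"
  shows "(x - z) * (\<Sum>k = Suc a..b. x ^ (n - k) * z ^ (k - 1)) =
    x ^ (n - a) * z ^ a - x ^ (n - b) * z ^ b"
proof -
  let ?t = "\<lambda>k. x ^ (n - k) * z ^ k"
  have "(x - z) * (x ^ (n - k) * z ^ (k - 1)) = - (?t k - ?t (k - 1))" if "k \<in> {Suc a..b}" for k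
  proof -
    from that \<open>b \<le> n\<close> obtain i where "k = Suc i" "n - i = Suc (n - k)"
      by (cases k) auto
    then show ?thesis
      by (simp add: algebra_simps)
  qed
  then have "(x - z) * (\<Sum>k = Suc a..b. x ^ (n - k) * z ^ (k - 1)) =
      - (\<Sum>k = Suc a..b. ?t k - ?t (k - 1))"
    by (simp add: sum_distrib_left flip: sum_negf)
  then show ?thesis
    using sum_telescope''[OF \<open>a \<le> b\<close>, of ?t] by simp
qed

lemma diff_mult_last_value_sum:
  fixes x y z :: "'a::comm_ring_1"
  assumes "j \<le> n"
  shows "(x - z) * last_value_sum n x y z j =
    x ^ Suc n * y ^ n - z ^ Suc n + (1 - y ^ n) * (x ^ (Suc n - j) * z ^ j)"
proof -
  let ?t = "\<lambda>k. x ^ (Suc n - k) * z ^ (k - 1)"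
  let ?g = "\<lambda>k. x ^ (Suc n - k) * y ^ (if k \<le> j then n else 0) * z ^ (k - 1)"
  have "last_value_sum n x y z j = sum ?g {Suc 0..j} + sum ?g {Suc j..Suc n}"
    using assms sum.ub_add_nat[of "Suc 0" j ?g "Suc n - j"] by (simp add: last_value_sum_def)
  also have "sum ?g {Suc 0..j} = y ^ n * sum ?t {Suc 0..j}"
    unfolding sum_distrib_left by (intro sum.cong) (auto simp: mult_ac)
  also have "sum ?g {Suc j..Suc n} = sum ?t {Suc j..Suc n}"
    by (intro sum.cong) auto
  finally have "(x - z) * last_value_sum n x y z j =
      y ^ n * ((x - z) * sum ?t {Suc 0..j}) + (x - z) * sum ?t {Suc j..Suc n}"
    by (simp only: distrib_left mult.left_commute)
  also have "\<dots> = y ^ n * (x ^ Suc n - x ^ (Suc n - j) * z ^ j) + (x ^ (Suc n - j) * z ^ j - z ^ Suc n)"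
    using assms diff_mult_geometric_sum[of 0 j "Suc n" x z]
      diff_mult_geometric_sum[of j "Suc n" "Suc n" x z] by simp
  finally show ?thesis
    by (simp add: algebra_simps)
qed

lemma homogeneous_monomial_eq_quotient_power:
  fixes x u z :: "'a::comm_monoid_mult"
  assumes xu: "x * u = 1" and j: "j \<in> {1..n}"
  shows "x ^ (Suc n - j) * z ^ j = x ^ n * z * (z * u) ^ (j - 1)"
proof -
  obtain i d where "j = Suc i" "n = d + i"
    using j by (metis One_nat_def Suc_le_D atLeastAtMost_iff le_add_diff_inverse2 Suc_leD)
  then have "x ^ n * z * (z * u) ^ (j - 1) = x ^ (Suc n - j) * z ^ j * (x * u) ^ i"
    by (simp add: power_add power_mult_distrib mult_ac)
  then show ?thesis by (simp add: xu)
qed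

lemma f_poly_recurrence:
  fixes x u y z :: "'a::comm_ring_1"
  assumes xu: "x * u = 1" and "1 \<le> n"
  shows "(x - z) * f_poly (Suc n) x y z =
    (x ^ Suc n * y ^ n - z ^ Suc n) * f_poly n x y 1
    + x ^ n * (1 - y ^ n) * z * f_poly n x y (z * u)"
proof -
  let ?P = "{\<sigma>. \<sigma> permutes {1..n}}"
  let ?c = "\<lambda>\<sigma>. x ^ inv_num n \<sigma> * y ^ maj n \<sigma>"
  have telescoped: "(x - z) * last_value_sum n x y z (\<sigma> n) =
      x ^ Suc n * y ^ n - z ^ Suc n + x ^ n * (1 - y ^ n) * z * (z * u) ^ (\<sigma> n - 1)"
    if "\<sigma> \<in> ?P" for \<sigma>
  proof -
    have "\<sigma> n \<in> {1..n}"
      using that \<open>1 \<le> n\<close> permutes_in_image[of \<sigma> "{1..n}" n] by simp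
    then show ?thesis
      by (simp only: atLeastAtMost_iff diff_mult_last_value_sum
          homogeneous_monomial_eq_quotient_power[OF xu])
        (simp only: mult_ac)
  qed
  have "(x - z) * f_poly (Suc n) x y z =
      (\<Sum>\<sigma> \<in> ?P. ?c \<sigma> * ((x - z) * last_value_sum n x y z (\<sigma> n)))"
    unfolding f_poly_Suc sum_distrib_left by (simp only: mult.left_commute)
  also have "\<dots> = (\<Sum>\<sigma> \<in> ?P. ?c \<sigma> *
      (x ^ Suc n * y ^ n - z ^ Suc n + x ^ n * (1 - y ^ n) * z * (z * u) ^ (\<sigma> n - 1)))"
    by (intro sum.cong refl) (simp only: telescoped)
  also have "\<dots> = (x ^ Suc n * y ^ n - z ^ Suc n) * f_poly n x y 1
      + x ^ n * (1 - y ^ n) * z * f_poly n x y (z * u)"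
    unfolding f_poly_def last_stat_def sum_distrib_left sum.distrib[symmetric]
    by (simp only: distrib_left mult_ac power_one mult_1_right mult_1_left)
  finally show ?thesis .
qed

lemma f_poly_1: "f_poly 1 x y z = 1"
proof -
  have "inv_num 1 id = 0" "maj 1 id = 0" "last_stat 1 id = 0"
    by (auto simp: inv_num_def maj_def last_stat_def card_eq_0_iff)
  then show ?thesis
    by (simp add: f_poly_def)
qed

theorem theorem2p1:
  shows "f_poly 1 LX LY LZ = 1 \<and>
    (\<forall>n\<ge>2. (LX - LZ) * f_poly n LX LY LZ =
        (LX ^ n * LY ^ (n - 1) - LZ ^ n) * f_poly (n - 1) LX LY 1
        + LX ^ (n - 1) * (1 - LY ^ (n - 1)) * LZ * f_poly (n - 1) LX LY (LZ * LX_inv))"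
proof (intro conjI allI impI)
  show "f_poly 1 LX LY LZ = 1" by (rule f_poly_1)
next
  fix n :: nat
  assume "2 \<le> n"
  then obtain m where n: "n = Suc m" and "1 \<le> m"
    by (cases n) auto
  then show "(LX - LZ) * f_poly n LX LY LZ =
        (LX ^ n * LY ^ (n - 1) - LZ ^ n) * f_poly (n - 1) LX LY 1
        + LX ^ (n - 1) * (1 - LY ^ (n - 1)) * LZ * f_poly (n - 1) LX LY (LZ * LX_inv)"
    unfolding n diff_Suc_1 by (intro f_poly_recurrence LX_mult_LX_inv)
qed

end
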